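(* For $\Re(s)>1$ one has $C_s=\log G_s(1)+\gamma$, and this identity yields a meromorphic continuation of $s\mapsto G_s(1)$ to $\mathbb C\setminus\{1\}$, namely $G_s(1)=\exp(C_s-\gamma)$ with $C_s$ the meromorphically continued function. Moreover, for $\Re(s)>1$, $$C_s=\frac1{\Gamma(s-1)}\int_0^1\frac{\log\Gamma(1-t)}{t}\,(-\log t)^{s-2}\,dt .$$
   Context: $\zeta$ is the Riemann zeta function, $\gamma$ is Euler's constant, $\Gamma$ is the gamma function. For $\Re(s)>1$, $C_s:=\gamma+\sum_{r=2}^{\infty}\frac{\zeta(r)}{r^s}$; this function extends meromorphically to the whole $s$-plane with a simple pole at $s=1$ as its only pole, and $C_s$ also denotes the extension. For $s\in\mathbb C$ and $|z|<1$, $$G_s(z):=\exp\left(\sum_{r=2}^{\infty}\frac{\zeta(r)}{r^s}z^r\right),$$ and $\log G_s(z)$ denotes the series in the exponent. For $\Re(s)>1$, $\log G_s(1)$ is the radial limit $\lim_{z\to1^-}\log G_s(z)$ and $G_s(1)=\exp(\log G_s(1))$. For $t\in(0,1)$, $\log\Gamma(1-t)$ is the real logarithm, and for $x>0$, $x^{s-2}=e^{(s-2)\log x}$. *)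

theory Defs
  imports "HOL-Complex_Analysis.Complex_Analysis"
begin

(* The Dirichlet series of the Riemann zeta function. It represents the zeta function on the
   half-plane Re s > 1, and it is only evaluated at integers r >= 2 below. *)
definition zeta :: "complex \<Rightarrow> complex" where
  "zeta s = (\<Sum>n. 1 / of_nat (Suc n) powr s)"

(* All series over r >= 2 are written with the index shift r = k + 2. *)

(* C_s on its half-plane of definition Re s > 1. *)
definition C_series :: "complex \<Rightarrow> complex" where
  "C_series s =
     euler_mascheroni + (\<Sum>k. zeta (of_nat (k + 2)) / of_nat (k + 2) powr s)"

(* The meromorphic continuation of C_s to the whole plane. A "nicely meromorphic" function is
   continuous away from its poles and takes the conventional value 0 at each pole; this makes
   the continuation unique as a total function, so that THE is appropriate. *)
definition C_ext :: "complex \<Rightarrow> complex" where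
  "C_ext = (THE f. f nicely_meromorphic_on UNIV \<and> (\<forall>s. Re s > 1 \<longrightarrow> f s = C_series s))"

(* log G_s(z) is by definition this series (for |z| < 1), not a branch of the logarithm
   applied to G_s(z). *)
definition log_G :: "complex \<Rightarrow> complex \<Rightarrow> complex" where
  "log_G s z = (\<Sum>k. zeta (of_nat (k + 2)) / of_nat (k + 2) powr s * z ^ (k + 2))"

definition log_G_one :: "complex \<Rightarrow> complex" where
  "log_G_one s = Lim (at_left 1) (\<lambda>x::real. log_G s (of_real x))"

definition G_one :: "complex \<Rightarrow> complex" where
  "G_one s = exp (log_G_one s)"

definition C_integrand :: "complex \<Rightarrow> real \<Rightarrow> complex" where
  "C_integrand s t = of_real (ln (Gamma (1 - t)) / t) * of_real (- ln t) powr (s - 2)"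

end

theory Submission
  imports Defs "HOL-Real_Asymp.Real_Asymp"
begin

text \<open>
  Writing \<open>\<zeta>(r) = 1 + (\<zeta>(r) - 1)\<close> gives \<open>C\<^sub>s = \<gamma> + (\<zeta>(s) - 1) + E(s)\<close>, where
  \<open>E(s) = \<Sum>\<^bsub>r\<ge>2\<^esub> (\<zeta>(r) - 1) / r\<^sup>s\<close> is entire because \<open>\<zeta>(r) - 1 = O(2\<^sup>-\<^sup>r)\<close>. So the
  continuation of \<open>C\<^sub>s\<close> reduces to that of \<open>\<zeta>\<close>. The latter is obtained strip by strip: expanding
  \<open>(n + 1)\<^bsup>1-s\<^esup>\<close> in powers of \<open>1/n\<close> and summing over \<open>n \<ge> 2\<close>, where the left-hand side telescopes,
  expresses \<open>(s - 1) (\<zeta>(s) - 1)\<close> through the values at \<open>s + 1, s + 2, \<dots>\<close> and a remainder that converges further to the left.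

  For the integral, taking logarithms in the Weierstrass product of \<open>\<Gamma>\<close> gives
  \<open>log \<Gamma>(1 - t) = \<gamma> t + \<Sum>\<^bsub>r\<ge>2\<^esub> \<zeta>(r) t\<^sup>r / r\<close>, which is integrated term by term against
  \<open>(- log t)\<^bsup>s-2\<^esup> / t\<close>; the substitution \<open>t = exp(- x / r)\<close> turns each term into Euler's integral for \<open>\<Gamma>(s - 1)\<close>.
\<close>

section \<open>Continuation of the zeta function\<close>

text \<open>The Weierstrass M-test on small closed discs gives locally uniform convergence. The
  majorant may depend on the disc, since no single one serves a whole half-plane for the series
  below.\<close>

lemma holomorphic_on_suminf_locally:
  fixes f :: "nat \<Rightarrow> complex \<Rightarrow> complex"
  assumes "open S" and hol: "\<And>n. f n holomorphic_on S"
    and bd: "\<And>x. x \<in> S \<Longrightarrow> \<exists>d>0. \<exists>M. summable M \<and> (\<forall>n. \<forall>y\<in>ball x d. y \<in> S \<longrightarrow> norm (f n y) \<le> M n)"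
  shows "(\<lambda>s. \<Sum>n. f n s) holomorphic_on S"
proof (rule holomorphic_uniform_sequence[OF \<open>open S\<close>])
  show "(\<lambda>s. \<Sum>i<n. f i s) holomorphic_on S" for n
    by (intro holomorphic_intros hol)
next
  fix x assume x: "x \<in> S"
  obtain d M where d: "d > 0" "summable M"
    and M: "\<And>n y. y \<in> ball x d \<Longrightarrow> y \<in> S \<Longrightarrow> norm (f n y) \<le> M n"
    using bd[OF x] by blast
  obtain e where e: "e > 0" "ball x e \<subseteq> S"
    using \<open>open S\<close> x openE by blast
  define r where "r = min d e / 2"
  have r: "r > 0" "cball x r \<subseteq> ball x d" "cball x r \<subseteq> ball x e"
    using d e by (auto simp: r_def min_def)
  have "uniform_limit (cball x r) (\<lambda>n s. \<Sum>i<n. f i s) (\<lambda>s. \<Sum>n. f n s) sequentially"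
    by (rule Weierstrass_m_test[OF _ d(2)]) (use M r e in blast)
  thus "\<exists>d>0. cball x d \<subseteq> S \<and> uniform_limit (cball x d) (\<lambda>n s. \<Sum>i<n. f i s) (\<lambda>s. \<Sum>n. f n s) sequentially"
    using r e by blast
qed

text \<open>Factor by factor, |a - i| <= A + i. The bound is the coefficient of x^k in (1 - x)^(-A),
  so one binomial series, convergent for |x| < 1, dominates all \<open>a\<close> in a disc.\<close>

lemma norm_gchoose_le:
  fixes a :: complex
  assumes "norm a \<le> A"
  shows "norm (a gchoose k) \<le> (-1) ^ k * ((-A) gchoose k)"
proof -
  have "norm (\<Prod>i<k. a - of_nat i) \<le> (\<Prod>i<k. A + of_nat i)"
  proof -
    have "norm (a - of_nat i) \<le> A + of_nat i" for i
      by (rule order_trans[OF norm_triangle_ineq4]) (use assms in auto)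
    thus ?thesis
      unfolding prod_norm[symmetric] by (intro prod_mono) auto
  qed
  also have "(\<Prod>i<k. A + of_nat i) = (-1) ^ k * (\<Prod>i<k. -A - of_nat i)"
    by (induction k) (auto simp: algebra_simps)
  finally have "norm (\<Prod>i<k. a - of_nat i) / fact k \<le> (-1) ^ k * (\<Prod>i<k. -A - of_nat i) / fact k"
    by (intro divide_right_mono) auto
  thus ?thesis
    by (simp add: gbinomial_prod_rev norm_divide atLeast0LessThan)
qed

section \<open>The function zeta(s) - 1 on its half-plane of convergence\<close>

text \<open>For Re s > 1 this is zeta(s) - 1. Starting at 2 makes its values at integers decay
  geometrically and keeps the expansion variable 1/(n + 2) at most 1/2.\<close>

definition zeta_tail :: "complex \<Rightarrow> complex" where
  "zeta_tail s = (\<Sum>n. of_nat (n + 2) powr (-s))"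

lemma norm_of_nat_powr:
  "n > 0 \<Longrightarrow> norm (of_nat n powr s :: complex) = of_nat n powr Re s"
  by (simp add: norm_powr_real_powr)

lemma summable_shift_powr:
  "a < -1 \<Longrightarrow> summable (\<lambda>n. real (n + m) powr a)"
  using summable_iff_shift[of "\<lambda>n. real n powr a" m] summable_real_powr_iff[of a] by simp

lemma summable_norm_zeta_tail:
  "Re s > 1 \<Longrightarrow> summable (\<lambda>n. norm (of_nat (n + 2) powr (-s) :: complex))"
  using summable_shift_powr[of "- Re s" 2] by (subst norm_of_nat_powr) auto

lemma sums_zeta_tail:
  "Re s > 1 \<Longrightarrow> (\<lambda>n. of_nat (n + 2) powr (-s)) sums zeta_tail s"
  unfolding zeta_tail_def by (intro summable_sums summable_norm_cancel[OF summable_norm_zeta_tail])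

lemma holomorphic_zeta_tail: "zeta_tail holomorphic_on {s. Re s > 1}"
proof -
  have "(\<lambda>s. \<Sum>n. of_nat (n + 2) powr (-s)) holomorphic_on {s. Re s > 1}"
  proof (rule holomorphic_on_suminf_locally)
    show "open {s. Re s > 1}" by (rule open_halfspace_Re_gt)
    show "(\<lambda>s. of_nat (n + 2) powr (-s)) holomorphic_on {s. Re s > 1}" for n
      by (intro holomorphic_intros)
    fix x assume x: "x \<in> {s. Re s > 1}"
    \<comment> \<open>Half the distance to the line Re s = 1, so that Re y >= 1 + d on the whole
      disc.\<close>
    define d where "d = (Re x - 1) / 2"
    have d: "d > 0" using x by (simp add: d_def)
    moreover have "summable (\<lambda>n. real (n + 2) powr (-(1 + d)))"
      using d by (intro summable_shift_powr) auto
    moreover have "norm (of_nat (n + 2) powr (-y) :: complex) \<le> real (n + 2) powr (-(1 + d))"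
      if "y \<in> ball x d" for n y
    proof -
      have "\<bar>Re x - Re y\<bar> < d"
        using that abs_Re_le_cmod[of "x - y"] by (simp add: dist_norm)
      hence "Re y \<ge> 1 + d" by (simp add: d_def field_simps abs_if split: if_splits)
      thus ?thesis by (subst norm_of_nat_powr) (auto intro!: powr_mono)
    qed
    ultimately show "\<exists>d>0. \<exists>M. summable M \<and> (\<forall>n. \<forall>y\<in>ball x d. y \<in> {s. 1 < Re s} \<longrightarrow>
       norm (of_nat (n + 2) powr (-y) :: complex) \<le> M n)"
      by blast
  qed
  thus ?thesis by (simp add: zeta_tail_def[abs_def])
qed

section \<open>Truncated binomial expansions and their sums\<close>

text \<open>The error left when the binomial expansion of ((n + 2) + 1)^(1 - s) is cut off after the
  term \<open>k = K\<close>.\<close>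

definition binom_remainder :: "nat \<Rightarrow> nat \<Rightarrow> complex \<Rightarrow> complex" where
  "binom_remainder K n s = of_nat (n + 3) powr (1 - s) -
     (\<Sum>k\<le>K. ((1 - s) gchoose k) * of_nat (n + 2) powr (1 - s - of_nat k))"

text \<open>The first omitted term, of index K + 1, has order (n + 2)^(- Re s - K). Each later one
  gains a factor of at most 1/2 from the power of n + 2, and the coefficients are dominated by those
  of (1 - x)^(-A), so a binomial series at 1/2 bounds the rest uniformly in \<open>n\<close> and
  \<open>s\<close>.\<close>

lemma binom_remainder_bound:
  "\<exists>C\<ge>0. \<forall>s n. norm (1 - s) \<le> A \<longrightarrow> norm (binom_remainder K n s) \<le> C * real (n + 2) powr (- Re s - real K)"
proof -
  define b where "b = (\<lambda>m. (-1) ^ m * ((-A) gchoose m) * (1/2) ^ m)"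
  have sb: "summable b"
    using gen_binomial_real[of "-1/2" "-A"] sums_summable
    unfolding b_def by (simp add: power_divide power_minus' mult_ac)
  have sb': "summable (\<lambda>k. b (k + Suc K))" using sb summable_iff_shift by blast
  \<comment> \<open>Only 2^-k is gained from the powers of x, whereas \<open>b (k + Suc K)\<close>
    contains 2^-(k + K + 1); the prefactor compensates.\<close>
  define C where "C = 2 ^ Suc K * (\<Sum>k. b (k + Suc K))"
  have main: "norm (binom_remainder K n s) \<le> C * real (n + 2) powr (- Re s - real K)"
    if s: "norm (1 - s) \<le> A" for s n
  proof -
    define a where "a = 1 - s"
    define x where "x = real (n + 2)"
    have x: "x \<ge> 2" by (simp add: x_def)
    have "(\<lambda>k. (a gchoose k) * of_real x powr (a - of_nat k) * of_real 1 ^ k) sums of_real (x + 1) powr a"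
      by (rule gen_binomial_complex'') (use x in auto)
    hence "(\<lambda>k. (a gchoose k) * of_real x powr (a - of_nat k)) sums of_real (x + 1) powr a" by simp
    hence "(\<lambda>k. (a gchoose (k + Suc K)) * of_real x powr (a - of_nat (k + Suc K))) sums
         (of_real (x + 1) powr a - (\<Sum>k<Suc K. (a gchoose k) * of_real x powr (a - of_nat k)))"
      by (subst sums_iff_shift) simp
    moreover have "of_real (x + 1) powr a - (\<Sum>k<Suc K. (a gchoose k) * of_real x powr (a - of_nat k))
        = binom_remainder K n s"
      unfolding binom_remainder_def a_def x_def lessThan_Suc_atMost by (simp add: algebra_simps)
    ultimately have S: "(\<lambda>k. (a gchoose (k + Suc K)) * of_real x powr (a - of_nat (k + Suc K))) sums
         binom_remainder K n s" by simp
    have bound: "norm ((a gchoose (k + Suc K)) * of_real x powr (a - of_nat (k + Suc K)))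
        \<le> 2 ^ Suc K * x powr (- Re s - K) * b (k + Suc K)" for k
    proof -
      have "norm (of_real x powr (a - of_nat (k + Suc K))) = x powr ((- Re s - K) - k)"
        using x by (subst norm_powr_real_powr) (auto simp: a_def algebra_simps)
      also have "\<dots> = x powr (- Re s - K) / x ^ k"
        using x by (subst powr_diff) (simp add: powr_realpow)
      also have "\<dots> \<le> x powr (- Re s - K) / 2 ^ k"
        using x by (intro divide_left_mono power_mono mult_pos_pos) auto
      finally have "norm (of_real x powr (a - of_nat (k + Suc K))) \<le> x powr (- Re s - K) / 2 ^ k" .
      hence "norm ((a gchoose (k + Suc K)) * of_real x powr (a - of_nat (k + Suc K))) \<le>
         ((-1) ^ (k + Suc K) * ((-A) gchoose (k + Suc K))) * (x powr (- Re s - K) / 2 ^ k)"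
        unfolding norm_mult
        using s by (intro mult_mono norm_gchoose_le order_trans[OF norm_ge_zero norm_gchoose_le[of a A]])
           (auto simp: a_def)
      also have "\<dots> = 2 ^ Suc K * x powr (- Re s - K) * b (k + Suc K)"
        by (simp add: b_def power_add power_divide field_simps)
      finally show ?thesis .
    qed
    have sm: "summable (\<lambda>k. 2 ^ Suc K * x powr (- Re s - K) * b (k + Suc K))"
      by (rule summable_mult[OF sb'])
    have "norm (binom_remainder K n s) \<le> (\<Sum>k. 2 ^ Suc K * x powr (- Re s - K) * b (k + Suc K))"
      unfolding sums_unique[OF S] by (rule norm_suminf_le[OF bound sm])
    also have "\<dots> = C * x powr (- Re s - K)"
      using suminf_mult[OF sb', of "2 ^ Suc K * x powr (- Re s - K)"] by (simp add: C_def)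
    finally show ?thesis by (simp add: x_def)
  qed
  \<comment> \<open>For negative \<open>A\<close> the bound is vacuous but \<open>C\<close> can be
    negative, hence the maximum with 0.\<close>
  show ?thesis
    by (rule exI[of _ "max C 0"]) (use main in \<open>fastforce intro: order_trans mult_right_mono\<close>)
qed

text \<open>The exponent - Re s - K of the remainder bound is below -1 exactly in this half-plane,
  so each further term of the expansion gains a strip of width 1.\<close>

lemma holomorphic_suminf_binom_remainder:
  "(\<lambda>s. \<Sum>n. binom_remainder K n s) holomorphic_on {s. Re s > 1 - real K}"
proof (rule holomorphic_on_suminf_locally)
  show "open {s. Re s > 1 - real K}" by (rule open_halfspace_Re_gt)
  show "binom_remainder K n holomorphic_on {s. Re s > 1 - real K}" for n
    unfolding binom_remainder_def gbinomial_prod_rev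
    by (intro holomorphic_intros) auto
  fix x assume x: "x \<in> {s. Re s > 1 - real K}"
  define d where "d = (Re x - (1 - real K)) / 2"
  have d: "d > 0" using x by (simp add: d_def)
  obtain C where C: "C \<ge> 0" "\<And>s n. norm (1 - s) \<le> norm (1 - x) + d \<Longrightarrow>
      norm (binom_remainder K n s) \<le> C * real (n + 2) powr (- Re s - real K)"
    using binom_remainder_bound[of "norm (1 - x) + d" K] by blast
  have "summable (\<lambda>n. C * real (n + 2) powr (-(1 + d)))"
    using d by (intro summable_shift_powr summable_mult) auto
  moreover have "norm (binom_remainder K n y) \<le> C * real (n + 2) powr (-(1 + d))"
    if y: "y \<in> ball x d" for n y
  proof -
    have "\<bar>Re x - Re y\<bar> < d"
      using that abs_Re_le_cmod[of "x - y"] by (simp add: dist_norm)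
    hence le: "- Re y - K \<le> - (1 + d)" by (simp add: d_def field_simps abs_if split: if_splits)
    have "norm (1 - y) \<le> norm (1 - x) + norm (x - y)"
      using norm_triangle_ineq[of "1 - x" "x - y"] by simp
    hence "norm (binom_remainder K n y) \<le> C * real (n + 2) powr (- Re y - real K)"
      using y by (intro C) (auto simp: dist_norm)
    also have "\<dots> \<le> C * real (n + 2) powr (-(1 + d))"
      using le C(1) by (intro mult_left_mono powr_mono) auto
    finally show ?thesis .
  qed
  ultimately show "\<exists>d>0. \<exists>M. summable M \<and> (\<forall>n. \<forall>y\<in>ball x d. y \<in> {s. Re s > 1 - real K} \<longrightarrow>
       norm (binom_remainder K n y) \<le> M n)"
    using d by blast
qed

text \<open>In the sum over \<open>n\<close>, the left-hand power and the term k = 0 telescope to -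
  2^(1 - s). Every term k >= 1 sums to a binomial coefficient times
  \<open>zeta_tail (s + k - 1)\<close>; the term k = 1 is the one containing
  \<open>zeta_tail s\<close>.\<close>

lemma suminf_binom_remainder:
  assumes s: "Re s > 1"
  shows "(\<Sum>n. binom_remainder (Suc N) n s) =
    (s - 1) * zeta_tail s - 2 powr (1 - s) - (\<Sum>j<N. ((1 - s) gchoose (j + 2)) * zeta_tail (s + of_nat (j + 1)))"
proof -
  have "((\<lambda>n. of_nat (n + 2) powr (1 - s) :: complex) \<longlongrightarrow> 0) sequentially"
  proof (rule Lim_null_comparison)
    show "\<forall>\<^sub>F n in sequentially. norm (of_nat (n + 2) powr (1 - s) :: complex) \<le> real (n + 2) powr (1 - Re s)"
      by (subst norm_of_nat_powr) auto
    show "((\<lambda>n. real (n + 2) powr (1 - Re s)) \<longlongrightarrow> 0) sequentially"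
      using s by real_asymp
  qed
  from telescope_sums[OF this] have "(\<lambda>n. of_nat (Suc n + 2) powr (1 - s) - of_nat (n + 2) powr (1 - s)) sums (0 - 2 powr (1 - s))"
    by simp
  moreover have "(\<lambda>n. \<Sum>k<Suc N. ((1 - s) gchoose Suc k) * of_nat (n + 2) powr - (s + of_nat k))
     sums (\<Sum>k<Suc N. ((1 - s) gchoose Suc k) * zeta_tail (s + of_nat k))"
    by (intro sums_sum sums_mult sums_zeta_tail) (use s in auto)
  ultimately have "(\<lambda>n. of_nat (Suc n + 2) powr (1 - s) - of_nat (n + 2) powr (1 - s) -
      (\<Sum>k<Suc N. ((1 - s) gchoose Suc k) * of_nat (n + 2) powr - (s + of_nat k)))
     sums (0 - 2 powr (1 - s) - (\<Sum>k<Suc N. ((1 - s) gchoose Suc k) * zeta_tail (s + of_nat k)))"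
    by (rule sums_diff)
  moreover have "of_nat (Suc n + 2) powr (1 - s) - of_nat (n + 2) powr (1 - s) -
      (\<Sum>k<Suc N. ((1 - s) gchoose Suc k) * of_nat (n + 2) powr - (s + of_nat k)) = binom_remainder (Suc N) n s" for n
    unfolding binom_remainder_def lessThan_Suc_atMost[symmetric] sum.lessThan_Suc_shift[of _ "Suc N"]
    by (simp add: algebra_simps eval_nat_numeral)
  ultimately have "(\<Sum>n. binom_remainder (Suc N) n s) =
     0 - 2 powr (1 - s) - (\<Sum>k<Suc N. ((1 - s) gchoose Suc k) * zeta_tail (s + of_nat k))"
    by (simp add: sums_iff)
  also have "(\<Sum>k<Suc N. ((1 - s) gchoose Suc k) * zeta_tail (s + of_nat k)) =
      (1 - s) * zeta_tail s + (\<Sum>j<N. ((1 - s) gchoose (j + 2)) * zeta_tail (s + of_nat (j + 1)))"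
    by (subst sum.lessThan_Suc_shift) simp
  finally show ?thesis by (simp add: algebra_simps)
qed

text \<open>
  The recursion involves \<open>zeta_tail (s + j + 1)\<close>, whose continuation has a pole at \<open>s = - j\<close>. The last
  factor \<open>1 - s - (j + 1)\<close> of \<open>(1 - s) gchoose (j + 2)\<close> cancels it, so that it can be written in terms of
  \<open>F s = (s - 1) * zeta_tail s\<close> alone.
\<close>
lemma zeta_tail_continuation_halfplane:
  "\<exists>F. F holomorphic_on {s. Re s > 1 - real N} \<and> (\<forall>s. Re s > 1 \<longrightarrow> F s = (s - 1) * zeta_tail s) \<and>
       (N > 0 \<longrightarrow> F 1 = 1)"
proof (induction N)
  case 0
  \<comment> \<open>This witness vanishes at 1, which lies on the boundary of the half-plane; the
    value 1 there is available only from N = 1 on.\<close>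
  show ?case
    by (rule exI[of _ "\<lambda>s. (s - 1) * zeta_tail s"]) (auto intro!: holomorphic_intros holomorphic_zeta_tail)
next
  case (Suc N)
  then obtain F where F: "F holomorphic_on {s. Re s > 1 - real N}"
    "\<And>s. Re s > 1 \<Longrightarrow> F s = (s - 1) * zeta_tail s" by blast
  define H where "H = (\<lambda>s. 2 powr (1 - s) + (\<Sum>n. binom_remainder (Suc N) n s) -
    (\<Sum>j<N. ((1 - s) gchoose (j + 1)) / of_nat (j + 2) * F (s + of_nat (j + 1))))"
  \<comment> \<open>A shift by at least 1 carries the larger half-plane into the one where
    \<open>F\<close> is already holomorphic.\<close>
  have "(\<lambda>s. F (s + of_nat (j + 1))) holomorphic_on {s. Re s > 1 - real (Suc N)}" for j
    by (rule holomorphic_on_compose_gen[OF _ F(1), of "\<lambda>s. s + of_nat (j + 1)" "{s. Re s > 1 - real (Suc N)}", unfolded o_def])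
       (auto intro!: holomorphic_intros)
  moreover have "(\<lambda>s. (1 - s) gchoose k) holomorphic_on A" for k A
    unfolding gbinomial_prod_rev by (intro holomorphic_intros) auto
  ultimately have "H holomorphic_on {s. Re s > 1 - real (Suc N)}"
    unfolding H_def by (intro holomorphic_intros holomorphic_suminf_binom_remainder) (auto simp del: of_nat_add)
  moreover have "H s = (s - 1) * zeta_tail s" if s: "Re s > 1" for s
  proof -
    have "((1 - s) gchoose (j + 2)) * zeta_tail (s + of_nat (j + 1)) =
       - (((1 - s) gchoose (j + 1)) / of_nat (j + 2) * F (s + of_nat (j + 1)))" for j
    proof -
      have "((1 - s) gchoose (j + 2)) = ((1 - s) gchoose (j + 1)) * (1 - s - of_nat (j + 1)) / of_nat (j + 2)"
        using gbinomial_absorption'[of "j + 2" "1 - s"] gbinomial_mult_1[of "1 - s" "j + 1"]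
        by (simp add: field_simps del: of_nat_Suc of_nat_add)
      moreover have "F (s + of_nat (j + 1)) = (s + of_nat j) * zeta_tail (s + of_nat (j + 1))"
        using s by (subst F(2)) auto
      moreover have "1 - s - of_nat (j + 1) = - (s + of_nat j)" by simp
      ultimately show ?thesis by (simp only: times_divide_eq_left times_divide_eq_right mult_minus_right mult_minus_left divide_minus_left mult_ac)
    qed
    thus ?thesis by (simp add: H_def suminf_binom_remainder[OF s] sum_negf)
  qed
  \<comment> \<open>At s = 1 the upper index is 0: all binomial coefficients of positive order
    vanish, the remainders are 1 - 1, and only 2^0 survives.\<close>
  moreover have "H 1 = 1"
  proof -
    have "binom_remainder (Suc N) n 1 = 0" for n
    proof -
      have "of_nat (n + 2) \<noteq> (0 :: complex)" "of_nat (n + 3) \<noteq> (0 :: complex)"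
        unfolding of_nat_eq_0_iff by auto
      thus ?thesis
        unfolding binom_remainder_def lessThan_Suc_atMost[symmetric] sum.lessThan_Suc_shift
        by (simp del: of_nat_add)
    qed
    thus ?thesis by (simp add: H_def)
  qed
  ultimately show ?case by blast
qed

text \<open>By the identity theorem the functions on the nested half-planes agree wherever both are
  holomorphic, so they glue to an entire function. The value 1 at s = 1 is the residue of zeta
  there.\<close>

lemma zeta_tail_continuation:
  "\<exists>F. F holomorphic_on UNIV \<and> (\<forall>s. Re s > 1 \<longrightarrow> F s = (s - 1) * zeta_tail s) \<and> F 1 = 1"
proof -
  have "\<exists>F. \<forall>N. F N holomorphic_on {s. Re s > 1 - real N} \<and> (\<forall>s. Re s > 1 \<longrightarrow> F N s = (s - 1) * zeta_tail s) \<and>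
       (N > 0 \<longrightarrow> F N 1 = 1)"
    using zeta_tail_continuation_halfplane by metis
  then obtain F where F: "\<And>N. F N holomorphic_on {s. Re s > 1 - real N}"
    "\<And>N s. Re s > 1 \<Longrightarrow> F N s = (s - 1) * zeta_tail s" "\<And>N. N > 0 \<Longrightarrow> F N 1 = (1 :: complex)" by blast
  have eq: "F M s = F N s" if "M \<le> N" "Re s > 1 - real M" for M N s
  proof (rule analytic_continuation_open[of "{s. Re s > 1}" "{s. Re s > 1 - real M}" "F M" "F N"])
    show "{s. Re s > 1} \<noteq> {}" by (auto intro!: exI[of _ "2 :: complex"])
    show "connected {s. Re s > 1 - real M}" by (intro convex_connected convex_halfspace_Re_gt)
    show "F N holomorphic_on {s. Re s > 1 - real M}"
      by (rule holomorphic_on_subset[OF F(1)]) (use that in auto)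
  qed (use F that in \<open>auto simp: open_halfspace_Re_gt\<close>)
  \<comment> \<open>The added 1 places \<open>s\<close> strictly inside the half-plane and keeps
    \<open>n s\<close> positive, as the value at 1 requires.\<close>
  define n where "n = (\<lambda>s. nat \<lceil>1 - Re s\<rceil> + 1)"
  define G where "G = (\<lambda>s. F (n s) s)"
  have GN: "G s = F N s" if "Re s > 1 - real N" for s N
  proof -
    have *: "Re s > 1 - real (n s)" unfolding n_def by linarith
    show ?thesis
    proof (cases "n s \<le> N")
      case True
      thus ?thesis unfolding G_def using * by (rule eq)
    next
      case False
      hence "N \<le> n s" by simp
      thus ?thesis unfolding G_def using that by (rule eq[symmetric])
    qed
  qed
  have "G holomorphic_on UNIV"
  proof (rule holomorphic_onI)
    fix s :: complex
    have s: "Re s > 1 - real (n s)" unfolding n_def by linarith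
    have "G holomorphic_on {z. Re z > 1 - real (n s)}"
      using F(1) by (rule holomorphic_transform) (use GN in auto)
    hence "G field_differentiable at s"
      by (rule holomorphic_on_imp_differentiable_at) (use s open_halfspace_Re_gt in auto)
    thus "G field_differentiable (at s within UNIV)" by simp
  qed
  moreover have "G s = (s - 1) * zeta_tail s" if "Re s > 1" for s
    using F(2)[OF that] by (simp add: G_def)
  moreover have "G 1 = 1" by (simp add: G_def F(3) n_def)
  ultimately show ?thesis by blast
qed

section \<open>Zeta at the integers\<close>

text \<open>A real-valued zeta at integers, so that sign, monotonicity and nonnegative double sums
  can be used.\<close>

definition zeta_nat :: "nat \<Rightarrow> real" where
  "zeta_nat k = (\<Sum>n. (1 / real (Suc n)) ^ k)"

lemma sums_zeta_nat: "k \<ge> 2 \<Longrightarrow> (\<lambda>n. (1 / real (Suc n)) ^ k) sums zeta_nat k"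
  unfolding zeta_nat_def
  using inverse_power_summable[of k, where 'a = real] summable_Suc_iff[of "\<lambda>n. inverse (real n ^ k)"]
  by (intro summable_sums) (simp add: power_divide inverse_eq_divide)

lemma zeta_of_nat:
  assumes "k \<ge> 2"
  shows "zeta (of_nat k) = of_real (zeta_nat k)"
proof -
  have "(\<lambda>n. of_real ((1 / real (Suc n)) ^ k) :: complex) sums of_real (zeta_nat k)"
    using sums_zeta_nat[OF assms] by (subst sums_of_real_iff)
  moreover have "of_real ((1 / real (Suc n)) ^ k) = 1 / of_nat (Suc n) powr (of_nat k :: complex)" for n
    by (subst powr_complexpow) (auto simp: power_divide simp del: of_nat_Suc)
  ultimately show ?thesis by (simp add: zeta_def sums_iff)
qed

lemma zeta_nat_nonneg: "k \<ge> 2 \<Longrightarrow> zeta_nat k \<ge> 0"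
  using sums_le[OF _ sums_zero sums_zeta_nat] by simp

lemma zeta_nat_le: "k \<ge> 2 \<Longrightarrow> zeta_nat k \<le> zeta_nat 2"
  by (rule sums_le[OF _ sums_zeta_nat sums_zeta_nat]) (auto intro!: power_decreasing)

lemma zeta_eq_zeta_tail:
  assumes "Re s > 1"
  shows "zeta s = 1 + zeta_tail s"
proof -
  have "(\<lambda>n. 1 / of_nat (Suc (Suc n)) powr s) sums zeta_tail s"
    using sums_zeta_tail[OF assms] by (simp add: powr_minus_divide)
  from sums_Suc[where f = "\<lambda>n. 1 / of_nat (Suc n) powr s", OF this] show ?thesis
    by (simp add: zeta_def sums_iff)
qed

text \<open>For m >= 2 one has m^-(k + 2) <= m^-2 2^-k. This geometric decay makes
  \<open>C_entire\<close> converge for every \<open>s\<close>.\<close>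

lemma norm_zeta_tail_le: "norm (zeta_tail (of_nat (k + 2))) \<le> zeta_nat 2 / 2 ^ k"
proof -
  have "(\<lambda>n. (1 / real (n + 2)) ^ 2) sums (zeta_nat 2 - 1)"
    using sums_zeta_nat[of 2] sums_Suc_iff[of "\<lambda>n. (1 / real (Suc n)) ^ 2" "zeta_nat 2 - 1"] by simp
  hence S: "(\<lambda>n. (1 / real (n + 2)) ^ 2 * (1 / 2 ^ k)) sums ((zeta_nat 2 - 1) * (1 / 2 ^ k))"
    by (rule sums_mult2)
  have "norm (of_nat (n + 2) powr (- of_nat (k + 2)) :: complex) \<le> (1 / real (n + 2)) ^ 2 * (1 / 2 ^ k)" for n
  proof -
    have "norm (of_nat (n + 2) powr (- of_nat (k + 2)) :: complex) = (1 / real (n + 2)) ^ (k + 2)"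
      using powr_realpow[of "real (n + 2)" "k + 2"]
      by (subst norm_of_nat_powr)
         (auto simp: powr_minus_divide power_one_over simp del: of_nat_add of_nat_Suc power_Suc)
    also have "\<dots> = (1 / real (n + 2)) ^ 2 * (1 / real (n + 2)) ^ k"
      by (simp only: power_add mult.commute)
    also have "\<dots> \<le> (1 / real (n + 2)) ^ 2 * (1 / 2) ^ k"
      by (intro mult_left_mono power_mono) (auto simp: field_simps)
    finally show ?thesis by (simp add: power_divide)
  qed
  hence "norm (zeta_tail (of_nat (k + 2))) \<le> (\<Sum>n. (1 / real (n + 2)) ^ 2 * (1 / 2 ^ k))"
    unfolding zeta_tail_def using S by (intro norm_suminf_le) (auto simp: sums_iff)
  also have "\<dots> \<le> zeta_nat 2 / 2 ^ k"
    using S by (simp add: sums_iff divide_right_mono)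
  finally show ?thesis .
qed

section \<open>Continuation of the constants\<close>

definition C_entire :: "complex \<Rightarrow> complex" where
  "C_entire s = (\<Sum>k. zeta_tail (of_nat (k + 2)) / of_nat (k + 2) powr s)"

lemma norm_C_entire_term_le:
  assumes "- Re s \<le> B"
  shows "norm (zeta_tail (of_nat (k + 2)) / of_nat (k + 2) powr s) \<le> zeta_nat 2 / 2 ^ k * real (k + 2) powr B"
proof -
  have "norm (zeta_tail (of_nat (k + 2)) / of_nat (k + 2) powr s) =
     norm (zeta_tail (of_nat (k + 2))) * real (k + 2) powr (- Re s)"
    by (simp only: norm_divide norm_of_nat_powr powr_minus_divide) (simp add: norm_of_nat_powr del: of_nat_add)
  also have "\<dots> \<le> zeta_nat 2 / 2 ^ k * real (k + 2) powr B"
    using assms by (intro mult_mono norm_zeta_tail_le powr_mono) (auto simp: zeta_nat_nonneg)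
  finally show ?thesis .
qed

lemma summable_C_entire_bound: "summable (\<lambda>k. zeta_nat 2 / 2 ^ k * real (k + 2) powr B)"
\<comment> \<open>Any ratio strictly between 1/2 and 1 would do; with 3/4 the quotient is (2/3)^k
  times a power of \<open>k + 2\<close>, which tends to 0.\<close>
proof (rule summable_comparison_test_bigo[of "\<lambda>k. (3 / 4) ^ k"])
  have "(\<lambda>k. real (k + 2) powr B * (2 / 3) ^ k) \<longlonglongrightarrow> 0"
    by real_asymp
  hence "(\<lambda>k. zeta_nat 2 * (real (k + 2) powr B * (2 / 3) ^ k)) \<longlonglongrightarrow> 0"
    by (rule tendsto_mult_right_zero)
  moreover have "zeta_nat 2 * (real (k + 2) powr B * (2 / 3) ^ k) =
      zeta_nat 2 / 2 ^ k * real (k + 2) powr B / (3 / 4) ^ k" for k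
  proof -
    have "(2 / 3 :: real) ^ k = (1 / 2 / (3 / 4)) ^ k" by simp
    also have "\<dots> = 1 / 2 ^ k / (3 / 4) ^ k" by (simp only: power_divide power_one)
    finally show ?thesis by simp
  qed
  ultimately show "(\<lambda>k. zeta_nat 2 / 2 ^ k * real (k + 2) powr B) \<in> O(\<lambda>k. (3 / 4) ^ k)"
    by (intro landau_o.small_imp_big smalloI_tendsto) auto
qed (simp add: summable_geometric)

lemma holomorphic_C_entire: "C_entire holomorphic_on UNIV"
proof -
  have "(\<lambda>s. \<Sum>k. zeta_tail (of_nat (k + 2)) / of_nat (k + 2) powr s) holomorphic_on UNIV"
  proof (rule holomorphic_on_suminf_locally)
    show "(\<lambda>s. zeta_tail (of_nat (n + 2)) / of_nat (n + 2) powr s) holomorphic_on UNIV" for n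
    proof -
      have "of_nat (n + 2) \<noteq> (0 :: complex)" unfolding of_nat_eq_0_iff by simp
      thus ?thesis by (intro holomorphic_intros) (simp del: of_nat_add)
    qed
    fix x :: complex
    have "- Re y \<le> norm x + 1" if "y \<in> ball x 1" for y
      using that abs_Re_le_cmod[of y] norm_triangle_ineq4[of x "x - y"] by (simp add: dist_norm)
    thus "\<exists>d>0. \<exists>M. summable M \<and> (\<forall>n. \<forall>y\<in>ball x d. y \<in> UNIV \<longrightarrow>
       norm (zeta_tail (of_nat (n + 2)) / of_nat (n + 2) powr y) \<le> M n)"
      using summable_C_entire_bound norm_C_entire_term_le
      by (intro exI[of _ 1] conjI exI[of _ "\<lambda>k. zeta_nat 2 / 2 ^ k * real (k + 2) powr (norm x + 1)"]) auto
  qed simp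
  thus ?thesis by (simp add: C_entire_def[abs_def])
qed

text \<open>Splitting zeta(r) = 1 + (zeta(r) - 1) in each coefficient, the ones contribute the sum
  of r^-s over r >= 2, which is \<open>zeta_tail\<close> again, now at \<open>s\<close>
  itself.\<close>

lemma C_series_eq:
  assumes "Re s > 1"
  shows "C_series s = euler_mascheroni + zeta_tail s + C_entire s"
proof -
  have "(\<lambda>k. zeta_tail (of_nat (k + 2)) / of_nat (k + 2) powr s) sums C_entire s"
    unfolding C_entire_def
    by (intro summable_sums summable_comparison_test'[OF summable_C_entire_bound norm_C_entire_term_le[OF order_refl]])
  from sums_add[OF sums_zeta_tail[OF assms] this]
  have "(\<lambda>k. zeta (of_nat (k + 2)) / of_nat (k + 2) powr s) sums (zeta_tail s + C_entire s)"
    by (subst zeta_eq_zeta_tail) (auto simp: powr_minus_divide add_divide_distrib)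
  thus ?thesis by (simp add: C_series_def sums_iff)
qed

section \<open>Uniqueness and nature of the meromorphic continuation\<close>

text \<open>The difference is meromorphic on the connected plane and vanishes near a point, hence
  off a sparse set. So \<open>f\<close> and \<open>g\<close> agree on a punctured neighbourhood of
  every point and share their poles; the value at the point is then forced, as 0 at a pole and as
  the limit elsewhere.\<close>

lemma nicely_meromorphic_unique:
  assumes f: "f nicely_meromorphic_on UNIV" and g: "g nicely_meromorphic_on UNIV"
    and S: "open S" "S \<noteq> {}" "\<And>z. z \<in> S \<Longrightarrow> f z = g z"
  shows "f = g"
proof
  fix z
  have mero: "(\<lambda>z. f z - g z) meromorphic_on UNIV"
    using f g unfolding nicely_meromorphic_on_def by (intro meromorphic_intros) auto
  obtain w where w: "w \<in> S" using S(2) by blast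
  have "eventually (\<lambda>z. f z = g z) (at w)"
    using S w eventually_at_topological by blast
  hence "\<not> eventually (\<lambda>z. f z - g z \<noteq> 0) (at w)"
    by (auto dest: eventually_conj simp: eventually_False trivial_limit_at)
  hence "\<not> (\<forall>\<^sub>\<approx>z\<in>UNIV. f z - g z \<noteq> 0)"
    by (auto simp: eventually_cosparse_open_eq)
  with meromorphic_imp_constant_or_avoid[OF mero open_UNIV connected_UNIV, of 0]
  have "\<forall>\<^sub>\<approx>z\<in>UNIV. f z - g z = 0" by blast
  hence ev: "eventually (\<lambda>x. f x = g x) (at z)"
    by (auto simp: eventually_cosparse_open_eq)
  have pole: "is_pole f z \<longleftrightarrow> is_pole g z" by (rule is_pole_cong[OF ev refl])
  show "f z = g z"
  proof (cases "is_pole f z")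
    case True
    thus ?thesis using f g pole unfolding nicely_meromorphic_on_def
      by (metis UNIV_I at_neq_bot is_pole_def not_tendsto_and_filterlim_at_infinity)
  next
    case False
    hence "f \<midarrow>z\<rightarrow> f z" "g \<midarrow>z\<rightarrow> g z" using f g pole unfolding nicely_meromorphic_on_def by auto
    moreover have "f \<midarrow>z\<rightarrow> g z" using calculation(2) tendsto_cong[OF ev] by blast
    ultimately show ?thesis using LIM_unique by blast
  qed
qed

text \<open>The continuation is g(s)/(s - 1) with \<open>g\<close> entire and g(1) = 1, from which
  the simple pole is read off; uniqueness identifies this quotient with
  \<open>C_ext\<close>.\<close>

lemma C_ext_properties:
  "C_ext meromorphic_on UNIV" "C_ext holomorphic_on (- {1})" "is_pole C_ext 1" "zorder C_ext 1 = -1"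
  "Re s > 1 \<Longrightarrow> C_ext s = C_series s"
proof -
  obtain F where F: "F holomorphic_on UNIV" "\<And>s. Re s > 1 \<Longrightarrow> F s = (s - 1) * zeta_tail s" "F 1 = 1"
    using zeta_tail_continuation by blast
  define g where "g = (\<lambda>s. F s + (s - 1) * (euler_mascheroni + C_entire s))"
  \<comment> \<open>The value 0 at 1 is the convention for poles of a nicely meromorphic
    function.\<close>
  define f where "f = (\<lambda>s. if s = 1 then 0 else g s / (s - 1))"
  have g: "g holomorphic_on UNIV" "g 1 = 1"
    unfolding g_def using F by (auto intro!: holomorphic_intros holomorphic_C_entire)
  have hol: "f holomorphic_on (- {1})"
  proof (rule holomorphic_transform)
    show "(\<lambda>s. g s / (s - 1)) holomorphic_on (- {1})"
      by (intro holomorphic_intros holomorphic_on_subset[OF g(1)]) auto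
  qed (auto simp: f_def)
  have ev: "eventually (\<lambda>s. f s = g s / (s - 1) ^ 1) (at 1)"
    by (auto simp: eventually_at_filter f_def)
  have "is_pole (\<lambda>s. g s / (s - 1) ^ 1) 1"
    by (rule is_pole_basic[OF g(1)]) (use g in auto)
  hence pole: "is_pole f 1" by (subst is_pole_cong[OF ev refl])
  have ord: "zorder f 1 = -1"
    by (rule zorder_eqI[OF open_UNIV _ g(1)]) (use g in \<open>auto simp: f_def power_int_minus divide_inverse\<close>)
  have f_eq: "f s = C_series s" if "Re s > 1" for s
    using that by (auto simp: f_def g_def F(2) C_series_eq field_simps)
  have nice: "f nicely_meromorphic_on UNIV"
  proof (rule nicely_meromorphic_onI_open[where pts = "{1}"])
    show "f analytic_on UNIV - {1}"
      using hol by (simp add: analytic_on_open Compl_eq_Diff_UNIV open_delete)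
    show "is_pole f x \<and> f x = 0" if "x \<in> {1}" for x
      using that pole by (auto simp: f_def)
    show "isolated_singularity_at f x" for x
    proof (cases "x = 1")
      case True
      show ?thesis
        by (rule isolated_singularity_at_holomorphic[OF _ open_UNIV])
           (use hol True in \<open>simp_all add: Compl_eq_Diff_UNIV\<close>)
    next
      case False
      show ?thesis
        by (rule isolated_singularity_at_holomorphic[OF holomorphic_on_subset[OF hol], of "- {1}"])
           (use False in auto)
    qed
  qed auto
  have "C_ext = f"
    unfolding C_ext_def
  proof (rule the_equality)
    fix h assume h: "h nicely_meromorphic_on UNIV \<and> (\<forall>s. Re s > 1 \<longrightarrow> h s = C_series s)"
    show "h = f"
    proof (rule nicely_meromorphic_unique[OF _ nice, of h "{s. Re s > 1}"])
      show "{s. Re s > 1} \<noteq> {}" by (auto intro!: exI[of _ "2 :: complex"])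
    qed (use h f_eq in \<open>auto simp: open_halfspace_Re_gt\<close>)
  qed (use nice f_eq in auto)
  with nice hol pole ord f_eq show "C_ext meromorphic_on UNIV" "C_ext holomorphic_on (- {1})"
    "is_pole C_ext 1" "zorder C_ext 1 = -1" "Re s > 1 \<Longrightarrow> C_ext s = C_series s"
    by (auto simp: nicely_meromorphic_on_def)
qed

section \<open>The radial limit\<close>

lemma norm_log_G_term_le:
  assumes "norm z \<le> 1"
  shows "norm (zeta (of_nat (k + 2)) / of_nat (k + 2) powr s * z ^ (k + 2)) \<le> zeta_nat 2 * real (k + 2) powr (- Re s)"
proof -
  have "norm (zeta (of_nat (k + 2)) / of_nat (k + 2) powr s * z ^ (k + 2)) =
     zeta_nat (k + 2) * real (k + 2) powr (- Re s) * norm z ^ (k + 2)"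
    by (subst zeta_of_nat) (simp_all only: norm_mult norm_divide norm_power norm_of_nat_powr
       zeta_nat_nonneg powr_minus_divide norm_of_real abs_of_nonneg le_add2 complex_Re_of_nat, simp)
  also have "\<dots> \<le> zeta_nat 2 * real (k + 2) powr (- Re s) * 1"
    using assms by (intro mult_mono zeta_nat_le power_le_one) (auto simp: zeta_nat_nonneg)
  finally show ?thesis by simp
qed

text \<open>For Re s > 1 the terms have a summable majorant independent of z on the closed unit
  disc, so \<open>log_G s\<close> is continuous up to the boundary and the limit is the series at z
  = 1.\<close>

lemma log_G_radial_limit:
  assumes s: "Re s > 1"
  shows "((\<lambda>x::real. log_G s (of_real x)) \<longlongrightarrow> C_series s - euler_mascheroni) (at_left 1)"
proof -
  have "uniform_limit (cball 0 1) (\<lambda>n z. \<Sum>k<n. zeta (of_nat (k + 2)) / of_nat (k + 2) powr s * z ^ (k + 2)) (log_G s) sequentially"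
    unfolding log_G_def
  proof (rule Weierstrass_m_test)
    show "summable (\<lambda>k. zeta_nat 2 * real (k + 2) powr (- Re s))"
      using s by (intro summable_mult summable_shift_powr) auto
  qed (rule norm_log_G_term_le, simp)
  hence "continuous_on (cball 0 1) (log_G s)"
    by (rule uniform_limit_theorem[OF always_eventually, rotated])
       (rule trivial_limit_sequentially, intro allI continuous_on_sum continuous_on_mult
         continuous_on_const continuous_on_power continuous_on_id)
  hence "continuous_on {0..1} (\<lambda>x. log_G s (of_real x))"
    by (rule continuous_on_compose2) (auto intro!: continuous_intros)
  hence "((\<lambda>x. log_G s (of_real x)) \<longlongrightarrow> log_G s (of_real 1)) (at 1 within {0..1})"
    unfolding continuous_on_def by (rule bspec) simp
  hence "((\<lambda>x. log_G s (of_real x)) \<longlongrightarrow> log_G s (of_real 1)) (at_left 1)"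
    by (simp add: at_within_Icc_at_left)
  thus ?thesis by (simp add: C_series_def log_G_def)
qed

lemma log_G_one_eq:
  assumes "Re s > 1"
  shows "log_G_one s = C_series s - euler_mascheroni"
  unfolding log_G_one_def using log_G_radial_limit[OF assms] by (intro tendsto_Lim) auto

section \<open>The integral representation\<close>

lemma sums_ln_one_minus:
  assumes "\<bar>x\<bar> < (1 :: real)"
  shows "(\<lambda>k. x ^ (k + 2) / real (k + 2)) sums (- ln (1 - x) - x)"
proof -
  have "(\<lambda>n. x ^ n / real n) sums - ln (1 - x)"
    using sums_minus[OF ln_series'[of "-x"]] assms by simp
  \<comment> \<open>The two removed terms are x^0 / 0, which is 0 by convention, and x.\<close>
  hence "(\<lambda>n. x ^ (n + 2) / real (n + 2)) sums (- ln (1 - x) - (\<Sum>n<2. x ^ n / real n))"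
    by (subst sums_iff_shift) simp
  thus ?thesis by (simp add: eval_nat_numeral)
qed

text \<open>The logarithmic Weierstrass product at z = -t. There \<open>ln z\<close> and
  \<open>ln_Gamma z\<close> are not real, but the terms of the series are, so its sum
  \<open>S\<close> is real; exp S = Gamma(1 - t) exp(- gamma t) then determines \<open>S\<close> as
  a real logarithm.\<close>

lemma sums_ln_Gamma_one_minus_product:
  assumes t: "0 < t" "t < (1 :: real)"
  shows "(\<lambda>n. - ln (1 - t / real (Suc n)) - t / real (Suc n)) sums (ln (Gamma (1 - t)) - euler_mascheroni * t)"
proof -
  define z where "z = complex_of_real (- t)"
  define S where "S = ln_Gamma z + euler_mascheroni * z + ln z"
  define f where "f = (\<lambda>n. - ln (1 - t / real (Suc n)) - t / real (Suc n))"
  have z: "z \<notin> \<int>\<^sub>\<le>\<^sub>0"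
  proof
    assume "z \<in> \<int>\<^sub>\<le>\<^sub>0"
    then obtain n where "z = - of_nat n" by (auto elim: nonpos_Ints_cases')
    hence "complex_of_real t = of_real (real n)" by (simp add: z_def)
    hence "t = real n" by (simp only: of_real_eq_iff)
    thus False using t by auto
  qed
  have pos: "1 - t / real (Suc n) > 0" for n using t by (simp add: field_simps)
  have "z / of_nat (Suc n) - ln (1 + z / of_nat (Suc n)) = of_real (f n)" for n
  proof -
    have "1 + z / of_nat (Suc n) = of_real (1 - t / real (Suc n))" by (simp add: z_def)
    hence "ln (1 + z / of_nat (Suc n)) = of_real (ln (1 - t / real (Suc n)))"
      using pos[of n] by (simp only: Ln_of_real)
    thus ?thesis by (simp add: f_def z_def)
  qed
  with ln_Gamma_series'_aux[OF z] have sums: "(\<lambda>n. of_real (f n)) sums S" by (simp add: S_def)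
  have f: "f sums Re S" using sums_Re[OF sums] by simp
  have "(\<lambda>n. of_real (f n)) sums complex_of_real (Re S)"
    using f by (subst sums_of_real_iff)
  hence S: "S = of_real (Re S)" using sums sums_unique2 by blast
  have "exp S = Gamma z * z * exp (euler_mascheroni * z)"
    using z t by (simp add: S_def exp_add[of _ "Ln z"] exp_add Gamma_complex_altdef) (simp add: z_def)
  also have "Gamma z * z = Gamma (z + 1)"
    using z by (subst Gamma_plus1) auto
  also have "z + 1 = of_real (1 - t)" by (simp add: z_def)
  also have "Gamma (of_real (1 - t)) * exp (euler_mascheroni * z) =
      complex_of_real (Gamma (1 - t) * exp (- euler_mascheroni * t))"
    unfolding Gamma_complex_of_real z_def by (simp flip: exp_of_real)
  also have "exp S = of_real (exp (Re S))" by (subst S) (simp add: exp_of_real)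
  finally have "exp (Re S) = Gamma (1 - t) * exp (- euler_mascheroni * t)"
    by (simp only: of_real_eq_iff)
  hence "Re S = ln (Gamma (1 - t) * exp (- euler_mascheroni * t))" by (metis ln_exp)
  also have "\<dots> = ln (Gamma (1 - t)) - euler_mascheroni * t"
    using t by (subst ln_mult) (auto simp: Gamma_real_pos_exp)
  finally show ?thesis using f by (simp add: f_def)
qed

text \<open>A double series of nonnegative terms is summed in both orders: over \<open>n\<close>
  first it produces the zeta values, over \<open>k\<close> first the logarithmic factors of the
  Weierstrass product.\<close>

lemma sums_ln_Gamma_one_minus:
  assumes t: "0 < t" "t < (1 :: real)"
  shows "(\<lambda>k. zeta_nat (k + 2) * t ^ (k + 2) / real (k + 2)) sums (ln (Gamma (1 - t)) - euler_mascheroni * t)"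
proof -
  define f where "f = (\<lambda>(k, n). (t / real (Suc n)) ^ (k + 2) / real (k + 2))"
  have f_nonneg: "f (k, n) \<ge> 0" for k n using t by (simp add: f_def)
  have inner: "((\<lambda>n. f (k, n)) has_sum (zeta_nat (k + 2) * t ^ (k + 2) / real (k + 2))) UNIV" for k
  proof (rule sums_nonneg_imp_has_sum)
    have "(\<lambda>n. (1 / real (Suc n)) ^ (k + 2) * (t ^ (k + 2) / real (k + 2))) sums
        (zeta_nat (k + 2) * (t ^ (k + 2) / real (k + 2)))"
      by (intro sums_mult2 sums_zeta_nat) simp
    thus "(\<lambda>n. f (k, n)) sums (zeta_nat (k + 2) * t ^ (k + 2) / real (k + 2))"
      by (simp add: f_def power_divide mult.commute del: power_Suc of_nat_Suc)
  qed (rule f_nonneg)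
  have "summable (\<lambda>k. zeta_nat (k + 2) * t ^ (k + 2) / real (k + 2))"
  proof (rule summable_comparison_test')
    show "summable (\<lambda>k. zeta_nat 2 * t ^ k)"
      using t by (intro summable_mult summable_geometric) auto
    fix k :: nat
    have "zeta_nat (k + 2) * t ^ (k + 2) / real (k + 2) \<le> zeta_nat (k + 2) * t ^ (k + 2) / 1"
      using t by (intro divide_left_mono mult_nonneg_nonneg zeta_nat_nonneg) auto
    also have "\<dots> \<le> zeta_nat 2 * t ^ k / 1"
      using t by (intro divide_right_mono mult_mono zeta_nat_le power_decreasing) (auto simp: zeta_nat_nonneg)
    finally show "norm (zeta_nat (k + 2) * t ^ (k + 2) / real (k + 2)) \<le> zeta_nat 2 * t ^ k"
      using t zeta_nat_nonneg[of "k + 2"] by simp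
  qed
  hence summ: "(\<lambda>k. zeta_nat (k + 2) * t ^ (k + 2) / real (k + 2)) summable_on UNIV"
    by (rule summable_nonneg_imp_summable_on) (use t zeta_nat_nonneg in simp)
  have "f summable_on UNIV \<times> UNIV"
    using inner summ f_nonneg by (rule summable_on_SigmaI)
  then obtain T where T: "(f has_sum T) (UNIV \<times> UNIV)" unfolding summable_on_def by blast
  have 1: "(\<lambda>k. zeta_nat (k + 2) * t ^ (k + 2) / real (k + 2)) sums T"
    using has_sum_SigmaD[OF T inner] by (rule has_sum_imp_sums)
  have T': "((\<lambda>(n, k). f (k, n)) has_sum T) (UNIV \<times> UNIV)"
    using T by (subst (asm) has_sum_swap)
  have "((\<lambda>k. (\<lambda>(n, k). f (k, n)) (n, k)) has_sum (- ln (1 - t / real (Suc n)) - t / real (Suc n))) UNIV" for n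
  proof (rule sums_nonneg_imp_has_sum)
    have "\<bar>t / real (Suc n)\<bar> < 1" using t by (simp add: field_simps)
    from sums_ln_one_minus[OF this]
    show "(\<lambda>k. (\<lambda>(n, k). f (k, n)) (n, k)) sums (- ln (1 - t / real (Suc n)) - t / real (Suc n))"
      by (simp add: f_def)
  qed (use f_nonneg in simp)
  from has_sum_SigmaD[OF T' this]
  have "(\<lambda>n. - ln (1 - t / real (Suc n)) - t / real (Suc n)) sums T" by (rule has_sum_imp_sums)
  hence "T = ln (Gamma (1 - t)) - euler_mascheroni * t"
    using sums_ln_Gamma_one_minus_product[OF t] sums_unique2 by blast
  with 1 show ?thesis by simp
qed

section \<open>Logarithmic moments on (0,1) and termwise integration\<close>

lemma of_real_powr_eq_exp: "x > 0 \<Longrightarrow> complex_of_real x powr w = exp (w * of_real (ln x))"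
  by (simp add: powr_def Ln_of_real)

lemma log_moment:
  fixes z :: complex and k :: nat
  assumes z: "Re z > 0"
  defines "f \<equiv> \<lambda>t. of_real t ^ k * complex_of_real (- ln t) powr (z - 1)"
  shows "set_integrable lborel {0<..<1} f"
    "set_lebesgue_integral lborel {0<..<1} f = Gamma z / of_nat (Suc k) powr z"
proof -
  define r where "r = real (Suc k)"
  have r: "r > 0" by (simp add: r_def)
  define g where "g = (\<lambda>x. exp (- x / r))"
  define h where "h = (\<lambda>x. - exp (- x / r) / r)"
  define G where "G = (\<lambda>t. complex_of_real t powr (z - 1) / of_real (exp t))"
  have img: "g ` {0<..} = {0<..<1}"
  proof (intro equalityI subsetI)
    fix y :: real assume "y \<in> {0<..<1}"
    hence "y = g (- r * ln y)" "- r * ln y \<in> {0<..}"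
      using r by (auto simp: g_def mult_pos_neg)
    thus "y \<in> g ` {0<..}" by blast
  qed (use r in \<open>auto simp: g_def\<close>)
  have inj: "inj_on g {0<..}" using r by (auto simp: inj_on_def g_def)
  have der: "(g has_field_derivative h x) (at x within {0<..})" for x
    unfolding g_def h_def using r by (auto intro!: derivative_eq_intros)
  \<comment> \<open>The Jacobian exp(-x/r)/r raises exp(-x/r)^k to exp(-x), since r = k + 1, and its
    1/r joins r^(1 - z) to give r^-z. With every factor written as an exponential, only exponents
    need comparing.\<close>
  have eq: "\<bar>h x\<bar> *\<^sub>R f (g x) = G x / of_nat (Suc k) powr z" if "x \<in> {0<..}" for x
  proof -
    have x: "x > 0" using that by simp
    have "\<bar>h x\<bar> *\<^sub>R f (g x) = of_real (exp (- x / r) * exp (- ln r)) * (of_real (exp (- x / r)) ^ k * of_real (x / r) powr (z - 1))"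
    proof -
      have "\<bar>h x\<bar> = exp (- x / r) * exp (- ln r)"
        using r by (simp add: h_def exp_minus field_simps)
      moreover have "- ln (g x) = x / r"
        by (simp add: g_def)
      ultimately show ?thesis by (simp add: f_def g_def scaleR_conv_of_real)
    qed
    also have "of_real (x / r) powr (z - 1) = exp ((z - 1) * (of_real (ln x) - of_real (ln r)))"
      using x r by (subst of_real_powr_eq_exp) (auto simp: ln_div)
    also have "of_real (exp (- x / r)) ^ k = (exp (of_real (- x / r * real k)) :: complex)"
    proof -
      have "exp (- x / r) ^ k = exp (- x / r * real k)"
        by (simp only: exp_of_nat_mult[symmetric] mult.commute)
      thus ?thesis by (simp only: exp_of_real of_real_power[symmetric])
    qed
    also have "of_real (exp (- x / r) * exp (- ln r)) = (exp (of_real (- x / r - ln r)) :: complex)"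
      unfolding exp_of_real exp_add[symmetric] by simp
    also have "exp (of_real (- x / r - ln r)) * (exp (of_real (- x / r * real k)) * exp ((z - 1) * (of_real (ln x) - of_real (ln r)))) =
       exp (of_real (- (x / r * real (Suc k))) - z * of_real (ln r) + (z - 1) * of_real (ln x))"
      unfolding exp_add[symmetric] by (rule arg_cong[of _ _ exp]) (simp add: algebra_simps add_divide_distrib)
    also have "x / r * real (Suc k) = x" using r by (simp add: r_def)
    also have "exp (of_real (- x) - z * of_real (ln r) + (z - 1) * of_real (ln x)) = G x / of_real r powr z"
      using x r by (simp add: G_def of_real_powr_eq_exp exp_add exp_diff exp_minus exp_of_real field_simps)
    finally show ?thesis by (simp add: r_def)
  qed
  have absG: "G absolutely_integrable_on {0<..}"
    unfolding G_def by (rule absolutely_integrable_Gamma_integral'[OF z])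
  have "(\<lambda>x. G x / of_nat (Suc k) powr z) absolutely_integrable_on {0<..}"
    using absG by (rule set_integrable_divide)
  hence "(\<lambda>x. \<bar>h x\<bar> *\<^sub>R f (g x)) absolutely_integrable_on {0<..}"
    by (rule set_integrable_cong[THEN iffD1, rotated -1]) (use eq in auto)
  moreover have "integral {0<..} (\<lambda>x. \<bar>h x\<bar> *\<^sub>R f (g x)) = Gamma z / of_nat (Suc k) powr z"
  proof -
    have "integral {0<..} (\<lambda>x. \<bar>h x\<bar> *\<^sub>R f (g x)) = integral {0<..} (\<lambda>x. G x / of_nat (Suc k) powr z)"
      by (rule integral_cong) (use eq in auto)
    also have "((\<lambda>x. G x / of_nat (Suc k) powr z) has_integral Gamma z / of_nat (Suc k) powr z) {0<..}"
      unfolding G_def by (intro has_integral_divide Gamma_integral_complex' z)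
    hence "integral {0<..} (\<lambda>x. G x / of_nat (Suc k) powr z) = Gamma z / of_nat (Suc k) powr z"
      by (rule integral_unique)
    finally show ?thesis .
  qed
  ultimately have *: "f absolutely_integrable_on {0<..<1} \<and> integral {0<..<1} f = Gamma z / of_nat (Suc k) powr z"
    using has_absolute_integral_change_of_variables_real[OF _ der inj, of f "Gamma z / of_nat (Suc k) powr z"]
    unfolding img by auto
  \<comment> \<open>Borel measurability transfers integrability from the completed Lebesgue measure
    to \<open>lborel\<close>.\<close>
  have meas: "(\<lambda>t. indicator {0<..<1} t *\<^sub>R f t) \<in> borel_measurable borel"
    unfolding f_def by measurable
  thus si: "set_integrable lborel {0<..<1} f"
    using * unfolding set_integrable_def by (subst (asm) integrable_completion) auto
  show "set_lebesgue_integral lborel {0<..<1} f = Gamma z / of_nat (Suc k) powr z"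
    using set_borel_integral_eq_integral(2)[OF si] * by simp
qed

text \<open>Taking norms replaces \<open>z\<close> by its real part, so this is the previous moment
  at a real exponent. It controls the exchange of sum and integral.\<close>

lemma norm_log_moment:
  fixes z :: complex
  assumes z: "Re z > 0"
  shows "(LINT t|lborel. norm (indicator {0<..<1} t *\<^sub>R (of_real t ^ k * complex_of_real (- ln t) powr (z - 1)))) =
     Gamma (Re z) / real (Suc k) powr Re z"
proof -
  have "complex_of_real (LINT t|lborel. norm (indicator {0<..<1} t *\<^sub>R (of_real t ^ k * complex_of_real (- ln t) powr (z - 1))))
    = (LINT t|lborel. complex_of_real (norm (indicator {0<..<1} t *\<^sub>R (of_real t ^ k * complex_of_real (- ln t) powr (z - 1)))))"
    by (rule integral_complex_of_real[symmetric])
  also have "\<dots> = set_lebesgue_integral lborel {0<..<1} (\<lambda>t. of_real t ^ k * complex_of_real (- ln t) powr (of_real (Re z) - 1))"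
    unfolding set_lebesgue_integral_def
  proof (intro Bochner_Integration.integral_cong refl)
    fix t :: real
    show "complex_of_real (norm (indicator {0<..<1} t *\<^sub>R (of_real t ^ k * complex_of_real (- ln t) powr (z - 1)))) =
      indicator {0<..<1} t *\<^sub>R (of_real t ^ k * complex_of_real (- ln t) powr (of_real (Re z) - 1))"
    proof (cases "t \<in> {0<..<1}")
      case True
      hence "norm (complex_of_real (- ln t) powr (z - 1)) = (- ln t) powr (Re z - 1)"
        by (subst norm_powr_real_powr) (auto simp del: of_real_minus)
      moreover have "complex_of_real (- ln t) powr (of_real (Re z) - 1) = of_real ((- ln t) powr (Re z - 1))"
        using True powr_of_real[of "- ln t" "Re z - 1"] by simp
      ultimately show ?thesis using True by (simp add: norm_mult norm_power del: of_real_minus)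
    qed auto
  qed
  also have "\<dots> = Gamma (of_real (Re z)) / of_nat (Suc k) powr of_real (Re z)"
    by (rule log_moment) (use z in simp)
  also have "\<dots> = of_real (Gamma (Re z) / real (Suc k) powr Re z)"
    using powr_of_real[of "real (Suc k)" "Re z"] by (simp add: Gamma_complex_of_real)
  finally show ?thesis by (simp only: of_real_eq_iff)
qed

text \<open>The series of log Gamma(1 - t)/t is integrated termwise. The integrals of the absolute
  values are O((k + 1)^(- Re s)), hence summable, which justifies the exchange.\<close>

lemma C_series_integral:
  assumes s: "Re s > 1"
  shows "set_integrable lborel {0<..<1} (C_integrand s)"
    "C_series s = 1 / Gamma (s - 1) * set_lebesgue_integral lborel {0<..<1} (C_integrand s)"
proof -
  define z where "z = s - 1"
  have z: "Re z > 0" using s by (simp add: z_def)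
  \<comment> \<open>The coefficient of t^k in log Gamma(1 - t)/t: zeta(r)/r with r = k + 1, where
    gamma takes the place of the divergent zeta(1).\<close>
  define c where "c = (\<lambda>k. (case k of 0 \<Rightarrow> euler_mascheroni | Suc j \<Rightarrow> zeta_nat (j + 2)) / real (Suc k))"
  define B where "B = \<bar>euler_mascheroni\<bar> + zeta_nat 2"
  have B_nonneg: "B \<ge> 0" by (simp add: B_def zeta_nat_nonneg)
  define m where "m = (\<lambda>k t. indicator {0<..<1} t *\<^sub>R (of_real t ^ k * complex_of_real (- ln t) powr (z - 1)))"
  define f where "f = (\<lambda>k t. complex_of_real (c k) * m k t)"
  have c_le: "\<bar>c k\<bar> \<le> B / real (Suc k)" for k
    using zeta_nat_le zeta_nat_nonneg
    by (auto simp: c_def B_def abs_divide split: nat.split intro!: divide_right_mono add_increasing)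
  have int_m: "integrable lborel (m k)" for k
    using log_moment(1)[OF z, of k] unfolding m_def set_integrable_def .
  have f_int: "integrable lborel (f k)" for k
    unfolding f_def using int_m by (intro integrable_mult_right) auto
  have f_sums: "(\<lambda>k. f k t) sums (indicator {0<..<1} t *\<^sub>R C_integrand s t)" for t
  proof (cases "t \<in> {0<..<1}")
    case True
    hence t: "0 < t" "t < 1" by auto
    have series: "(\<lambda>k. zeta_nat (k + 2) * t ^ (k + 2) / real (k + 2) / t) sums ((ln (Gamma (1 - t)) - euler_mascheroni * t) / t)"
      by (intro sums_divide sums_ln_Gamma_one_minus t)
    have "(\<lambda>k. c (Suc k) * t ^ Suc k) sums (ln (Gamma (1 - t)) / t - euler_mascheroni)"
    proof -
      have "zeta_nat (k + 2) * t ^ (k + 2) / real (k + 2) / t = c (Suc k) * t ^ Suc k" for k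
        using t by (simp add: c_def)
      moreover have "(ln (Gamma (1 - t)) - euler_mascheroni * t) / t = ln (Gamma (1 - t)) / t - euler_mascheroni"
        using t by (simp add: diff_divide_distrib)
      ultimately show ?thesis
        using series by (simp only:)
    qed
    hence "(\<lambda>k. c k * t ^ k) sums (ln (Gamma (1 - t)) / t)"
      by (subst (asm) sums_Suc_iff) (simp add: c_def)
    hence "(\<lambda>k. complex_of_real (c k * t ^ k)) sums of_real (ln (Gamma (1 - t)) / t)"
      by (subst sums_of_real_iff)
    hence "(\<lambda>k. of_real (c k * t ^ k) * complex_of_real (- ln t) powr (z - 1)) sums
        (of_real (ln (Gamma (1 - t)) / t) * complex_of_real (- ln t) powr (z - 1))"
      by (rule sums_mult2)
    thus ?thesis using True by (simp add: f_def m_def C_integrand_def z_def mult_ac diff_diff_eq)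
  qed (auto simp: f_def m_def)
  have f_abs: "summable (\<lambda>k. norm (f k t))" for t
  proof (cases "t \<in> {0<..<1}")
    case True
    define P where "P = norm (complex_of_real (- ln t) powr (z - 1))"
    have "summable (\<lambda>k. B * t ^ k * P)"
      using True by (intro summable_mult summable_mult2 summable_geometric) auto
    moreover have "norm (norm (f k t)) \<le> B * t ^ k * P" for k
    proof -
      have "\<bar>c k\<bar> \<le> B"
        using B_nonneg by (intro order_trans[OF c_le]) (simp add: divide_le_eq mult_le_cancel_left1)
      thus ?thesis using True
        by (auto simp: f_def m_def norm_mult norm_power P_def mult.assoc intro!: mult_right_mono)
    qed
    ultimately show ?thesis by (rule summable_comparison_test')
  qed (auto simp: f_def m_def)
  have "(\<integral>t. norm (f k t) \<partial>lborel) = \<bar>c k\<bar> * (Gamma (Re z) / real (Suc k) powr Re z)" for k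
  proof -
    have "(\<integral>t. norm (f k t) \<partial>lborel) = (\<integral>t. \<bar>c k\<bar> * norm (m k t) \<partial>lborel)"
      by (simp only: f_def norm_mult norm_of_real)
    also have "\<dots> = \<bar>c k\<bar> * (\<integral>t. norm (m k t) \<partial>lborel)"
      by (rule integral_mult_right_zero)
    finally show ?thesis by (simp only: m_def norm_log_moment[OF z])
  qed
  moreover have "summable (\<lambda>k. \<bar>c k\<bar> * (Gamma (Re z) / real (Suc k) powr Re z))"
  proof (rule summable_comparison_test')
    show "summable (\<lambda>k. B * Gamma (Re z) * real (k + 1) powr (- Re s))"
      using s by (intro summable_mult summable_shift_powr) auto
    fix k
    have G: "Gamma (Re z) > 0" using z by (rule Gamma_real_pos)
    have "\<bar>c k\<bar> * (Gamma (Re z) / real (Suc k) powr Re z) \<le> B / real (Suc k) * (Gamma (Re z) / real (Suc k) powr Re z)"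
      using c_le G by (intro mult_right_mono) auto
    also have "\<dots> = B * Gamma (Re z) * (1 / (real (Suc k) powr 1 * real (Suc k) powr Re z))"
      by simp
    also have "real (Suc k) powr 1 * real (Suc k) powr Re z = real (Suc k) powr Re s"
      unfolding powr_add[symmetric] by (simp add: z_def)
    finally show "norm (\<bar>c k\<bar> * (Gamma (Re z) / real (Suc k) powr Re z)) \<le> B * Gamma (Re z) * real (k + 1) powr (- Re s)"
      using G by (simp add: powr_minus_divide abs_mult)
  qed
  ultimately have int_summable: "summable (\<lambda>k. \<integral>t. norm (f k t) \<partial>lborel)" by simp
  have suminf_eq: "(\<Sum>k. f k t) = indicator {0<..<1} t *\<^sub>R C_integrand s t" for t
    using f_sums by (simp add: sums_iff)
  show "set_integrable lborel {0<..<1} (C_integrand s)"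
    using integrable_suminf[OF f_int AE_I2[OF f_abs] int_summable]
    unfolding suminf_eq set_integrable_def .
  have "(\<lambda>k. integral\<^sup>L lborel (f k)) sums set_lebesgue_integral lborel {0<..<1} (C_integrand s)"
    using sums_integral[OF f_int AE_I2[OF f_abs] int_summable]
    unfolding suminf_eq set_lebesgue_integral_def .
  moreover have "integral\<^sup>L lborel (f k) / Gamma z = of_real (c k * real (Suc k)) / of_nat (Suc k) powr s" for k
  proof -
    have "integral\<^sup>L lborel (f k) = of_real (c k) * integral\<^sup>L lborel (m k)"
      unfolding f_def by (rule integral_mult_right_zero)
    also have "integral\<^sup>L lborel (m k) = Gamma z / of_nat (Suc k) powr z"
      using log_moment(2)[OF z, of k] unfolding m_def set_lebesgue_integral_def .
    finally have "integral\<^sup>L lborel (f k) = of_real (c k) * (Gamma z / of_nat (Suc k) powr z)" .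
    moreover have "of_nat (Suc k) powr s = of_nat (Suc k) powr z * complex_of_nat (Suc k)"
      using powr_add[of "complex_of_nat (Suc k)" z 1] by (simp add: z_def del: of_nat_Suc)
    moreover have "Gamma z \<noteq> 0"
      using z by (auto simp: Gamma_eq_zero_iff elim!: nonpos_Ints_cases')
    ultimately show ?thesis by (simp del: of_nat_Suc)
  qed
  ultimately have "(\<lambda>k. of_real (c k * real (Suc k)) / of_nat (Suc k) powr s) sums
     (set_lebesgue_integral lborel {0<..<1} (C_integrand s) / Gamma z)"
    using sums_divide[of "\<lambda>k. integral\<^sup>L lborel (f k)" _ "Gamma z"] by (simp only:)
  \<comment> \<open>The term k = 0 equals gamma and moves to the right-hand side, leaving the sum
    over r >= 2.\<close>
  hence "(\<lambda>k. of_real (c (Suc k) * real (Suc (Suc k))) / of_nat (Suc (Suc k)) powr s) sums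
     (set_lebesgue_integral lborel {0<..<1} (C_integrand s) / Gamma z - euler_mascheroni)"
    by (subst sums_Suc_iff) (simp add: c_def)
  moreover have "of_real (c (Suc k) * real (Suc (Suc k))) / of_nat (Suc (Suc k)) powr s =
     zeta (of_nat (k + 2)) / of_nat (k + 2) powr s" for k
    by (subst zeta_of_nat) (simp_all add: c_def)
  ultimately have "(\<lambda>k. zeta (of_nat (k + 2)) / of_nat (k + 2) powr s) sums
     (set_lebesgue_integral lborel {0<..<1} (C_integrand s) / Gamma z - euler_mascheroni)"
    by (simp only:)
  from sums_unique[OF this]
  show "C_series s = 1 / Gamma (s - 1) * set_lebesgue_integral lborel {0<..<1} (C_integrand s)"
    unfolding C_series_def z_def by (metis add.commute diff_add_cancel mult_1 times_divide_eq_left)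
qed

theorem theorem3p6:
  shows "(C_ext meromorphic_on UNIV \<and> C_ext holomorphic_on (- {1}) \<and>
           is_pole C_ext 1 \<and> zorder C_ext 1 = -1 \<and>
           (\<forall>s. Re s > 1 \<longrightarrow> C_ext s = C_series s))
       \<and> (\<forall>s. Re s > 1 \<longrightarrow>
           ((\<lambda>x::real. log_G s (of_real x)) \<longlongrightarrow> log_G_one s) (at_left 1) \<and>
           C_series s = log_G_one s + euler_mascheroni)
       \<and> ((\<lambda>s. exp (C_ext s - euler_mascheroni)) meromorphic_on (- {1}) \<and>
           (\<forall>s. Re s > 1 \<longrightarrow> G_one s = exp (C_ext s - euler_mascheroni)))
       \<and> (\<forall>s. Re s > 1 \<longrightarrow>
           set_integrable lborel {0<..<1} (C_integrand s) \<and>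
           C_series s = 1 / Gamma (s - 1) * set_lebesgue_integral lborel {0<..<1} (C_integrand s))"
proof (intro conjI allI impI)
  \<comment> \<open>The pole of \<open>C_ext\<close> becomes an essential singularity of the
    exponential, so 1 stays excluded; elsewhere the function is even holomorphic.\<close>
  have "(\<lambda>s. exp (C_ext s - euler_mascheroni)) holomorphic_on (- {1})"
    by (intro holomorphic_intros C_ext_properties)
  thus "(\<lambda>s. exp (C_ext s - euler_mascheroni)) meromorphic_on (- {1})"
    by (intro analytic_on_imp_meromorphic_on) (subst analytic_on_open, auto)
next
  fix s :: complex assume s: "Re s > 1"
  show "((\<lambda>x::real. log_G s (of_real x)) \<longlongrightarrow> log_G_one s) (at_left 1)"
    using log_G_radial_limit[OF s] by (simp add: log_G_one_eq[OF s])
  show "C_series s = log_G_one s + euler_mascheroni"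
    by (simp add: log_G_one_eq[OF s])
  show "G_one s = exp (C_ext s - euler_mascheroni)"
    by (simp add: G_one_def log_G_one_eq[OF s] C_ext_properties(5)[OF s])
  show "C_series s = 1 / Gamma (s - 1) * set_lebesgue_integral lborel {0<..<1} (C_integrand s)"
    by (rule C_series_integral(2)[OF s])
qed (fact C_ext_properties | rule C_ext_properties C_series_integral; assumption)+

end
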